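(* Let $\mathcal{L}_1\subseteq\mathcal{L}_2$ be propositional languages, $\mathcal{L}_2$ extending $\mathcal{L}_1$ by some set of connectives. Let $\mathbf{G}_1$ be a coherent canonical system in $\mathcal{L}_1$, and let $\mathbf{G}_2$ be a coherent canonical system in $\mathcal{L}_2$ obtained from $\mathbf{G}_1$ by adding canonical rules for connectives in $\mathcal{L}_2\setminus\mathcal{L}_1$. Then $\mathbf{G}_2$ is a conservative extension of $\mathbf{G}_1$: for every set $\mathcal S$ of sequents and sequent $s$, all in $\mathcal{L}_1$, $\mathcal{S}\vdash^{seq}_{\mathbf{G}_1}s$ iff $\mathcal{S}\vdash^{seq}_{\mathbf{G}_2}s$.
   Context: For a propositional language $\mathcal{L}$ with atoms $p_1,p_2,\ldots$ and formulas $\mathcal{F}$: a sequent is $\Gamma\Rightarrow E$ with $\Gamma$ a finite set of formulas and $E$ a set of formulas with at most one element. A clause is a sequent of atoms. An $\mathcal{L}$-substitution is a map $\sigma:\mathcal{F}\to\mathcal{F}$ commuting with all connectives, extended pointwise to sets. A canonical right-introduction rule for an $n$-ary connective $\diamond$ is $\{\Pi_i\Rightarrow E_i\}_{1\le i\le m}/\ \Rightarrow\diamond(p_1,\dots,p_n)$ with $m\ge0$ and $\Pi_i\cup E_i\subseteq\{p_1,\dots,p_n\}$; an application infers $\Gamma\Rightarrow\sigma(\diamond(p_1,\dots,p_n))$ from $\Gamma,\sigma(\Pi_i)\Rightarrow\sigma(E_i)$ ($1\le i\le m$), for any finite $\Gamma$ and $\mathcal L$-substitution $\sigma$. A canonical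 left-introduction rule is $\langle\{\Pi_i\Rightarrow E_i\}_{1\le i\le m},\{\Sigma_j\Rightarrow\}_{1\le j\le k}\rangle/\ \diamond(p_1,\dots,p_n)\Rightarrow$ with all atoms among $p_1,\dots,p_n$; an application infers $\Gamma,\sigma(\diamond(p_1,\dots,p_n))\Rightarrow E$ from $\Gamma,\sigma(\Pi_i)\Rightarrow\sigma(E_i)$ and $\Gamma,\sigma(\Sigma_j)\Rightarrow E$, for any sequent $\Gamma\Rightarrow E$ and $\sigma$. A canonical system in $\mathcal L$ has axioms $\varphi\Rightarrow\varphi$ ($\varphi$ in $\mathcal L$), weakening (from $\Gamma\Rightarrow E$ infer $\Gamma,\Delta\Rightarrow E$; from $\Gamma\Rightarrow$ infer $\Gamma\Rightarrow\psi$), cut (from $\Gamma\Rightarrow\varphi$ and $\Delta,\varphi\Rightarrow E$ infer $\Gamma,\Delta\Rightarrow E$), and a set of canonical right- and left-introduction rules for connectives of $\mathcal L$, all sequents being in $\mathcal L$. $\mathcal{S}\vdash^{seq}_{\mathbf G}s$ means $s$ is derivable in $\mathbf G$ from the sequents of $\mathcal S$ as extra axioms. A classical assignment $u$ satisfies a clause $\Pi\Rightarrow E$ iff $u(p)=f$ for some $p\in\Pi$ or $E=\{q\}$ with $u(q)=t$; $\mathbf G$ is coherent iff for every connective $\diamond$, whenever $\mathbf G$ contains a left rule $\langle S_1,S_2\rangle/\diamond(p_1,\dots,p_n)\Rightarrow$ and a right rule $S_3/\Rightarrow\diamond(p_1,\dots,p_n)$, no assignment satisfies all clauses of $S_1\cup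 S_2\cup S_3$. *)

theory Defs
  imports Main "HOL-Library.FSet"
begin

record 'c language =
  connectives :: "'c set"
  arity :: "'c \<Rightarrow> nat"

text \<open>Atoms are numbered from 0, so \<open>Atom i\<close> is $p_{i+1}$, and $p_1, \dots, p_n$
  are the atoms with index below $n$. Connectives of arity 0 are allowed.\<close>

datatype 'c formula = Atom nat | Con 'c "'c formula list"

inductive_set formulas :: "'c language \<Rightarrow> 'c formula set" for L where
  Atom: "Atom i \<in> formulas L"
| Con: "\<lbrakk>c \<in> connectives L; length \<phi>s = arity L c; \<forall>\<phi>\<in>set \<phi>s. \<phi> \<in> formulas L\<rbrakk>
    \<Longrightarrow> Con c \<phi>s \<in> formulas L"

definition sublanguage :: "'c language \<Rightarrow> 'c language \<Rightarrow> bool" where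
  "sublanguage L1 L2 \<longleftrightarrow>
    connectives L1 \<subseteq> connectives L2 \<and> (\<forall>c\<in>connectives L1. arity L1 c = arity L2 c)"

text \<open>A right-hand side, being a set with at most one element, is an option.
  The datatype is polymorphic in order to cover both sequents of formulas and clauses;
  a clause consists of the indices of its atoms.\<close>

datatype 'a sequent = Sequent "'a fset" "'a option"  (infix \<open>\<Zsurj>\<close> 55)

type_synonym clause = "nat sequent"

definition sequents :: "'c language \<Rightarrow> 'c formula sequent set" where
  "sequents L = {s. set_sequent s \<subseteq> formulas L}"

text \<open>Only the behaviour of \<open>\<sigma>\<close> on the formulas of \<open>L\<close> is constrained.\<close>

definition substitution :: "'c language \<Rightarrow> ('c formula \<Rightarrow> 'c formula) \<Rightarrow> bool" where
  "substitution L \<sigma> \<longleftrightarrow>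
    (\<forall>\<phi>\<in>formulas L. \<sigma> \<phi> \<in> formulas L) \<and>
    (\<forall>c \<phi>s. Con c \<phi>s \<in> formulas L \<longrightarrow> \<sigma> (Con c \<phi>s) = Con c (map \<sigma> \<phi>s))"

text \<open>\<open>RightRule c S3\<close> is $S_3 / {}\Rightarrow c(p_1,\dots,p_n)$, and \<open>LeftRule c S1 S2\<close> is
  $\langle S_1, S_2\rangle / c(p_1,\dots,p_n)\Rightarrow{}$, where $n$ is the arity of $c$.\<close>

datatype 'c rule =
  RightRule (conn: 'c) "clause fset"
| LeftRule (conn: 'c) "clause fset" "clause fset"

definition principal :: "'c language \<Rightarrow> 'c \<Rightarrow> 'c formula" where
  "principal L c = Con c (map Atom [0..<arity L c])"

definition clauses_over :: "nat \<Rightarrow> clause fset \<Rightarrow> bool" where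
  "clauses_over n S \<longleftrightarrow> (\<forall>s. s |\<in>| S \<longrightarrow> set_sequent s \<subseteq> {..<n})"

fun canonical_rule :: "'c language \<Rightarrow> 'c rule \<Rightarrow> bool" where
  "canonical_rule L (RightRule c S3) \<longleftrightarrow> c \<in> connectives L \<and> clauses_over (arity L c) S3"
| "canonical_rule L (LeftRule c S1 S2) \<longleftrightarrow>
    c \<in> connectives L \<and> clauses_over (arity L c) S1 \<and> clauses_over (arity L c) S2 \<and>
    (\<forall>\<Sigma> E. (\<Sigma> \<Zsurj> E) |\<in>| S2 \<longrightarrow> E = None)"

text \<open>A canonical system is determined by its language and its set of canonical rules.\<close>

definition canonical_system :: "'c language \<Rightarrow> 'c rule set \<Rightarrow> bool" where
  "canonical_system L G \<longleftrightarrow> (\<forall>r\<in>G. canonical_rule L r)"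

inductive derivable ::
  "'c language \<Rightarrow> 'c rule set \<Rightarrow> 'c formula sequent set \<Rightarrow> 'c formula sequent \<Rightarrow> bool"
  for L G \<S> where
  assumption: "\<lbrakk>s \<in> \<S>; s \<in> sequents L\<rbrakk> \<Longrightarrow> derivable L G \<S> s"
| axiom: "\<phi> \<in> formulas L \<Longrightarrow> derivable L G \<S> ({|\<phi>|} \<Zsurj> Some \<phi>)"
| weak_left: "\<lbrakk>derivable L G \<S> (\<Gamma> \<Zsurj> E); fset \<Delta> \<subseteq> formulas L\<rbrakk>
    \<Longrightarrow> derivable L G \<S> (\<Gamma> |\<union>| \<Delta> \<Zsurj> E)"
| weak_right: "\<lbrakk>derivable L G \<S> (\<Gamma> \<Zsurj> None); \<psi> \<in> formulas L\<rbrakk>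
    \<Longrightarrow> derivable L G \<S> (\<Gamma> \<Zsurj> Some \<psi>)"
| cut: "\<lbrakk>derivable L G \<S> (\<Gamma> \<Zsurj> Some \<phi>); derivable L G \<S> (finsert \<phi> \<Delta> \<Zsurj> E)\<rbrakk>
    \<Longrightarrow> derivable L G \<S> (\<Gamma> |\<union>| \<Delta> \<Zsurj> E)"
| right_intro: "\<lbrakk>RightRule c S3 \<in> G; substitution L \<sigma>; fset \<Gamma> \<subseteq> formulas L;
      \<forall>\<Pi> E'. (\<Pi> \<Zsurj> E') |\<in>| S3 \<longrightarrow>
        derivable L G \<S> (\<Gamma> |\<union>| (\<lambda>i. \<sigma> (Atom i)) |`| \<Pi> \<Zsurj> map_option (\<lambda>i. \<sigma> (Atom i)) E')\<rbrakk>
    \<Longrightarrow> derivable L G \<S> (\<Gamma> \<Zsurj> Some (\<sigma> (principal L c)))"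
| left_intro: "\<lbrakk>LeftRule c S1 S2 \<in> G; substitution L \<sigma>; (\<Gamma> \<Zsurj> E) \<in> sequents L;
      \<forall>\<Pi> E'. (\<Pi> \<Zsurj> E') |\<in>| S1 \<longrightarrow>
        derivable L G \<S> (\<Gamma> |\<union>| (\<lambda>i. \<sigma> (Atom i)) |`| \<Pi> \<Zsurj> map_option (\<lambda>i. \<sigma> (Atom i)) E');
      \<forall>\<Sigma>. (\<Sigma> \<Zsurj> None) |\<in>| S2 \<longrightarrow>
        derivable L G \<S> (\<Gamma> |\<union>| (\<lambda>i. \<sigma> (Atom i)) |`| \<Sigma> \<Zsurj> E)\<rbrakk>
    \<Longrightarrow> derivable L G \<S> (finsert (\<sigma> (principal L c)) \<Gamma> \<Zsurj> E)"

fun satisfies :: "(nat \<Rightarrow> bool) \<Rightarrow> clause \<Rightarrow> bool" where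
  "satisfies u (\<Pi> \<Zsurj> E) \<longleftrightarrow> (\<exists>p. p |\<in>| \<Pi> \<and> \<not> u p) \<or> (\<exists>q. E = Some q \<and> u q)"

definition coherent :: "'c rule set \<Rightarrow> bool" where
  "coherent G \<longleftrightarrow> (\<forall>c S1 S2 S3. LeftRule c S1 S2 \<in> G \<longrightarrow> RightRule c S3 \<in> G \<longrightarrow>
    \<not> (\<exists>u. \<forall>s. s |\<in>| S1 |\<union>| S2 |\<union>| S3 \<longrightarrow> satisfies u s))"

end

theory Submission
  imports Defs
begin

text \<open>For the nontrivial direction, a sequent not derivable from \<open>\<S>\<close> in \<open>G1\<close> is refuted in the
  canonical Kripke model of \<open>G1\<close> and \<open>\<S>\<close>, whose worlds are the sets of \<open>L1\<close>-formulas maximal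
  among those not deriving some fixed right-hand side. The valuation extends to \<open>L2\<close> by recursion on
  formulas: a formula outside \<open>L1\<close> is true at a world iff the premises of some right rule hold
  there. Coherence of \<open>G2\<close> is exactly what makes this valuation respect the left rules, so
  \<open>G2\<close> is sound for a model that still refutes the sequent.\<close>

section \<open>Kripke models of canonical systems\<close>

text \<open>Polymorphic, so that one notion serves both sequents of formulas and clauses, whose
  atoms will stand for argument positions. An empty right-hand side counts as false.\<close>

fun holds :: "('a \<Rightarrow> bool) \<Rightarrow> 'a sequent \<Rightarrow> bool" where
  "holds u (\<Gamma> \<Zsurj> E) \<longleftrightarrow> (\<forall>\<phi>. \<phi> |\<in>| \<Gamma> \<longrightarrow> u \<phi>) \<longrightarrow> (\<exists>\<phi>. E = Some \<phi> \<and> u \<phi>)"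

lemma satisfies_iff_holds: "satisfies u s \<longleftrightarrow> holds u s"
  by (cases s) auto

lemma holds_cong:
  assumes "\<And>a. a \<in> set_sequent s \<Longrightarrow> u a = u' a"
  shows "holds u s \<longleftrightarrow> holds u' s"
  using assms by (cases s) auto

text \<open>The intuitionistic reading of a set of premises: it looks at all later worlds, whereas
  \<open>holds\<close> looks at one. In the canonical model the order of worlds is set
  inclusion.\<close>

definition supports ::
  "'w::order set \<Rightarrow> ('w \<Rightarrow> 'a \<Rightarrow> bool) \<Rightarrow> 'w \<Rightarrow> 'a sequent fset \<Rightarrow> bool" where
  "supports W u w S \<longleftrightarrow> (\<forall>s. s |\<in>| S \<longrightarrow> (\<forall>w'\<in>W. w \<le> w' \<longrightarrow> holds (u w') s))"

lemma supportsD: "supports W u w S \<Longrightarrow> s |\<in>| S \<Longrightarrow> w' \<in> W \<Longrightarrow> w \<le> w' \<Longrightarrow> holds (u w') s"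
  by (auto simp: supports_def)

lemma supports_mono: "supports W u w S \<Longrightarrow> w \<le> w' \<Longrightarrow> supports W u w' S"
  unfolding supports_def by (meson order_trans)

lemma holds_clause_cong:
  assumes "clauses_over n S" "s |\<in>| S" "\<And>i. i < n \<Longrightarrow> u i = u' i"
  shows "holds u s \<longleftrightarrow> holds u' s"
  using assms by (intro holds_cong) (auto simp: clauses_over_def)

lemma supports_cong:
  assumes "clauses_over n S" "\<And>w i. w \<in> W \<Longrightarrow> i < n \<Longrightarrow> u w i = u' w i"
  shows "supports W u w S \<longleftrightarrow> supports W u' w S"
  unfolding supports_def using holds_clause_cong[OF assms(1)] assms(2) by blast

text \<open>The semantics is nondeterministic: right rules give sufficient conditions for a compound
  formula to be true, left rules give sufficient conditions for it to be false, and neither need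
  determine its value. Atom \<open>i\<close> of a clause is read as the argument
  \<open>\<phi>s ! i\<close>. The clauses of \<open>S1\<close> are required at all later worlds, but
  those of \<open>S2\<close> only at \<open>w\<close>: their premises carry the right-hand side of
  the conclusion, which may fail at \<open>w\<close> and become true later.\<close>

definition kripke_model ::
  "'c language \<Rightarrow> 'c rule set \<Rightarrow> 'w::order set \<Rightarrow> ('w \<Rightarrow> 'c formula \<Rightarrow> bool) \<Rightarrow> bool" where
  "kripke_model L G W v \<longleftrightarrow>
    (\<forall>w\<in>W. \<forall>w'\<in>W. \<forall>\<phi>\<in>formulas L. w \<le> w' \<longrightarrow> v w \<phi> \<longrightarrow> v w' \<phi>) \<and>
    (\<forall>c S3 \<phi>s. RightRule c S3 \<in> G \<longrightarrow> Con c \<phi>s \<in> formulas L \<longrightarrow>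
      (\<forall>w\<in>W. supports W (\<lambda>w i. v w (\<phi>s ! i)) w S3 \<longrightarrow> v w (Con c \<phi>s))) \<and>
    (\<forall>c S1 S2 \<phi>s. LeftRule c S1 S2 \<in> G \<longrightarrow> Con c \<phi>s \<in> formulas L \<longrightarrow>
      (\<forall>w\<in>W. supports W (\<lambda>w i. v w (\<phi>s ! i)) w S1 \<longrightarrow>
        (\<forall>s. s |\<in>| S2 \<longrightarrow> holds (\<lambda>i. v w (\<phi>s ! i)) s) \<longrightarrow> \<not> v w (Con c \<phi>s)))"

lemma kripke_modelI:
  assumes "\<And>w w' \<phi>. \<lbrakk>w \<in> W; w' \<in> W; \<phi> \<in> formulas L; w \<le> w'; v w \<phi>\<rbrakk> \<Longrightarrow> v w' \<phi>"
    and "\<And>c S3 \<phi>s w. \<lbrakk>RightRule c S3 \<in> G; Con c \<phi>s \<in> formulas L; w \<in> W;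
      supports W (\<lambda>w i. v w (\<phi>s ! i)) w S3\<rbrakk> \<Longrightarrow> v w (Con c \<phi>s)"
    and "\<And>c S1 S2 \<phi>s w. \<lbrakk>LeftRule c S1 S2 \<in> G; Con c \<phi>s \<in> formulas L; w \<in> W;
      supports W (\<lambda>w i. v w (\<phi>s ! i)) w S1;
      \<And>s. s |\<in>| S2 \<Longrightarrow> holds (\<lambda>i. v w (\<phi>s ! i)) s; v w (Con c \<phi>s)\<rbrakk> \<Longrightarrow> False"
  shows "kripke_model L G W v"
  unfolding kripke_model_def using assms by blast

lemma
  assumes "kripke_model L G W v"
  shows kripke_model_persistent:
      "\<lbrakk>w \<in> W; w' \<in> W; \<phi> \<in> formulas L; w \<le> w'; v w \<phi>\<rbrakk> \<Longrightarrow> v w' \<phi>"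
    and kripke_model_right:
      "\<lbrakk>RightRule c S3 \<in> G; Con c \<phi>s \<in> formulas L; w \<in> W;
        supports W (\<lambda>w i. v w (\<phi>s ! i)) w S3\<rbrakk> \<Longrightarrow> v w (Con c \<phi>s)"
    and kripke_model_left:
      "\<lbrakk>LeftRule c S1 S2 \<in> G; Con c \<phi>s \<in> formulas L; w \<in> W;
        supports W (\<lambda>w i. v w (\<phi>s ! i)) w S1;
        \<And>s. s |\<in>| S2 \<Longrightarrow> holds (\<lambda>i. v w (\<phi>s ! i)) s\<rbrakk> \<Longrightarrow> \<not> v w (Con c \<phi>s)"
  using assms unfolding kripke_model_def by blast+

section \<open>Languages, substitutions and soundness\<close>

lemma Con_in_formulas_iff:
  "Con c \<phi>s \<in> formulas L \<longleftrightarrow>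
    c \<in> connectives L \<and> length \<phi>s = arity L c \<and> set \<phi>s \<subseteq> formulas L"
  by (auto elim: formulas.cases intro: formulas.Con)

lemma Con_in_formulas_nth:
  "Con c \<phi>s \<in> formulas L \<Longrightarrow> i < arity L c \<Longrightarrow> \<phi>s ! i \<in> formulas L"
  by (auto simp: Con_in_formulas_iff)

lemma sequent_in_sequents_iff:
  "(\<Gamma> \<Zsurj> E) \<in> sequents L \<longleftrightarrow> fset \<Gamma> \<subseteq> formulas L \<and> set_option E \<subseteq> formulas L"
  by (simp add: sequents_def)

lemma sublanguage_formulas: "sublanguage L1 L2 \<Longrightarrow> formulas L1 \<subseteq> formulas L2"
proof
  fix \<phi> assume L: "sublanguage L1 L2" and "\<phi> \<in> formulas L1"
  from this(2) show "\<phi> \<in> formulas L2"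
    by induction (use L in \<open>auto simp: sublanguage_def intro!: formulas.intros\<close>)
qed

lemma sublanguage_sequents: "sublanguage L1 L2 \<Longrightarrow> sequents L1 \<subseteq> sequents L2"
  using sublanguage_formulas by (fastforce simp: sequents_def)

lemma principal_in_formulas: "c \<in> connectives L \<Longrightarrow> principal L c \<in> formulas L"
  by (auto simp: principal_def Con_in_formulas_iff intro: formulas.Atom)

lemma substitution_principal:
  assumes "substitution L \<sigma>" "c \<in> connectives L"
  shows "\<sigma> (principal L c) = Con c (map (\<lambda>i. \<sigma> (Atom i)) [0..<arity L c])"
  using assms principal_in_formulas[OF assms(2)]
  by (simp add: substitution_def principal_def comp_def)

primrec subst :: "(nat \<Rightarrow> 'c formula) \<Rightarrow> 'c formula \<Rightarrow> 'c formula" where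
  "subst f (Atom i) = f i"
| "subst f (Con c \<phi>s) = Con c (map (subst f) \<phi>s)"

lemma substitution_subst:
  assumes "\<And>i. f i \<in> formulas L"
  shows "substitution L (subst f)"
proof -
  have "subst f \<phi> \<in> formulas L" if "\<phi> \<in> formulas L" for \<phi>
    using that by induction (auto simp: Con_in_formulas_iff assms)
  then show ?thesis by (simp add: substitution_def)
qed

lemma canonical_system_RightRule:
  "canonical_system L G \<Longrightarrow> RightRule c S3 \<in> G \<Longrightarrow>
    c \<in> connectives L \<and> clauses_over (arity L c) S3"
  by (force simp: canonical_system_def)

lemma canonical_system_LeftRule:
  "canonical_system L G \<Longrightarrow> LeftRule c S1 S2 \<in> G \<Longrightarrow>
    c \<in> connectives L \<and> clauses_over (arity L c) S1 \<and> clauses_over (arity L c) S2 \<and>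
    (\<forall>\<Sigma> E. (\<Sigma> \<Zsurj> E) |\<in>| S2 \<longrightarrow> E = None)"
  by (force simp: canonical_system_def)

section \<open>Derivability across languages, and soundness\<close>

lemma derivable_in_sequents:
  assumes "derivable L G \<S> s" "canonical_system L G"
  shows "s \<in> sequents L"
  using assms(1)
proof induction
  case (right_intro c S3 \<sigma> \<Gamma>)
  have "\<sigma> (principal L c) \<in> formulas L"
    using canonical_system_RightRule[OF assms(2) right_intro.hyps(1)] right_intro.hyps(2)
    by (simp add: substitution_def principal_in_formulas)
  then show ?case using right_intro.hyps(3) by (simp add: sequent_in_sequents_iff)
next
  case (left_intro c S1 S2 \<sigma> \<Gamma> E)
  have "\<sigma> (principal L c) \<in> formulas L"
    using canonical_system_LeftRule[OF assms(2) left_intro.hyps(1)] left_intro.hyps(2)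
    by (simp add: substitution_def principal_in_formulas)
  then show ?case using left_intro.hyps(3) by (simp add: sequent_in_sequents_iff)
qed (auto simp: sequent_in_sequents_iff)

text \<open>The only obstacle is that a substitution of \<open>L1\<close> is unconstrained outside
  \<open>L1\<close> and so need not be one of \<open>L2\<close>. It is replaced by the homomorphism
  with the same values on atoms, which yields the same instances of premises and principal
  formula.\<close>

lemma derivable_sublanguage:
  assumes "derivable L1 G1 \<S> s" "sublanguage L1 L2" "canonical_system L1 G1" "G1 \<subseteq> G2"
  shows "derivable L2 G2 \<S> s"
proof -
  note forms = sublanguage_formulas[OF assms(2)]
  have extend: "\<exists>\<tau>. substitution L2 \<tau> \<and> (\<forall>i. \<tau> (Atom i) = \<sigma> (Atom i)) \<and>
      \<tau> (principal L2 c) = \<sigma> (principal L1 c)"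
    if "substitution L1 \<sigma>" "c \<in> connectives L1" for \<sigma> c
  proof -
    let ?\<tau> = "subst (\<lambda>i. \<sigma> (Atom i))"
    have "substitution L2 ?\<tau>"
      using that(1) forms by (intro substitution_subst) (auto simp: substitution_def formulas.Atom)
    moreover have "?\<tau> (principal L2 c) = \<sigma> (principal L1 c)"
      using assms(2) that(2)
      by (simp add: substitution_principal[OF that])
        (simp add: principal_def sublanguage_def comp_def)
    ultimately show ?thesis
      by (intro exI[of _ ?\<tau>]) simp
  qed
  show ?thesis
    using assms(1)
  proof induction
    case (assumption s)
    then show ?case
      using sublanguage_sequents[OF assms(2)] by (auto intro: derivable.assumption)
  next
    case (axiom \<phi>)
    then show ?case using forms by (auto intro: derivable.axiom)
  next
    case (weak_left \<Gamma> E \<Delta>)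
    then show ?case using forms by (auto intro: derivable.weak_left)
  next
    case (weak_right \<Gamma> \<psi>)
    then show ?case using forms by (auto intro: derivable.weak_right)
  next
    case (cut \<Gamma> \<phi> \<Delta> E)
    then show ?case by (auto intro: derivable.cut)
  next
    case (right_intro c S3 \<sigma> \<Gamma>)
    obtain \<tau> where \<tau>: "substitution L2 \<tau>" "\<And>i. \<tau> (Atom i) = \<sigma> (Atom i)"
        "\<tau> (principal L2 c) = \<sigma> (principal L1 c)"
      using extend right_intro canonical_system_RightRule[OF assms(3)] by meson
    have "derivable L2 G2 \<S> (\<Gamma> \<Zsurj> Some (\<tau> (principal L2 c)))"
      by (rule derivable.right_intro[where ?S3.0 = S3]) (use right_intro assms(4) forms \<tau> in auto)
    then show ?case by (simp add: \<tau>)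
  next
    case (left_intro c S1 S2 \<sigma> \<Gamma> E)
    obtain \<tau> where \<tau>: "substitution L2 \<tau>" "\<And>i. \<tau> (Atom i) = \<sigma> (Atom i)"
        "\<tau> (principal L2 c) = \<sigma> (principal L1 c)"
      using extend left_intro canonical_system_LeftRule[OF assms(3)] by meson
    have "derivable L2 G2 \<S> (finsert (\<tau> (principal L2 c)) \<Gamma> \<Zsurj> E)"
      by (rule derivable.left_intro[where ?S1.0 = S1 and ?S2.0 = S2])
        (use left_intro assms(4) sublanguage_sequents[OF assms(2)] \<tau> in auto)
    then show ?case by (simp add: \<tau>)
  qed
qed

text \<open>In the rule cases persistence carries the true context \<Gamma> to every later world,
  and there the induction hypothesis makes the clauses of \<open>S3\<close> or \<open>S1\<close>
  hold. This is why the induction keeps the world arbitrary.\<close>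

lemma derivable_sound:
  assumes "derivable L G \<S> s" "canonical_system L G" "kripke_model L G W v"
    and "\<And>t w. t \<in> \<S> \<Longrightarrow> w \<in> W \<Longrightarrow> holds (v w) t"
    and "w \<in> W"
  shows "holds (v w) s"
  using assms(1,5)
proof (induction arbitrary: w)
  case (assumption s)
  then show ?case using assms(4) by blast
next
  case (cut \<Gamma> \<phi> \<Delta> E)
  from cut.IH[OF cut.prems] show ?case by auto
next
  case (right_intro c S3 \<sigma> \<Gamma>)
  define \<phi>s where "\<phi>s = map (\<lambda>i. \<sigma> (Atom i)) [0..<arity L c]"
  have c: "c \<in> connectives L" "clauses_over (arity L c) S3"
    using canonical_system_RightRule[OF assms(2)] right_intro.hyps(1) by auto
  have p: "\<sigma> (principal L c) = Con c \<phi>s"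
    using substitution_principal right_intro.hyps c by (auto simp: \<phi>s_def)
  have f: "Con c \<phi>s \<in> formulas L"
    using principal_in_formulas[OF c(1)] right_intro.hyps(2) p by (metis substitution_def)
  have "v w (Con c \<phi>s)" if \<Gamma>: "\<forall>\<phi>. \<phi> |\<in>| \<Gamma> \<longrightarrow> v w \<phi>"
  proof (rule kripke_model_right[OF assms(3) right_intro.hyps(1) f right_intro.prems])
    have "supports W (\<lambda>w i. v w (\<sigma> (Atom i))) w S3"
      unfolding supports_def
    proof (intro allI impI ballI)
      fix s w' assume s: "s |\<in>| S3" and w': "w' \<in> W" "w \<le> w'"
      obtain \<Pi> E' where "s = \<Pi> \<Zsurj> E'" by (cases s)
      moreover have "\<forall>\<phi>. \<phi> |\<in>| \<Gamma> \<longrightarrow> v w' \<phi>"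
        using \<Gamma> kripke_model_persistent[OF assms(3) right_intro.prems w'(1)] w'
          right_intro.hyps(3) by blast
      ultimately show "holds (\<lambda>i. v w' (\<sigma> (Atom i))) s"
        using right_intro.IH s w'(1) by fastforce
    qed
    then show "supports W (\<lambda>w i. v w (\<phi>s ! i)) w S3"
      by (subst supports_cong[OF c(2)]) (auto simp: \<phi>s_def)
  qed
  then show ?case by (simp add: p)
next
  case (left_intro c S1 S2 \<sigma> \<Gamma> E)
  define \<phi>s where "\<phi>s = map (\<lambda>i. \<sigma> (Atom i)) [0..<arity L c]"
  have c: "c \<in> connectives L" "clauses_over (arity L c) S1" "clauses_over (arity L c) S2"
      "\<forall>\<Sigma> E. (\<Sigma> \<Zsurj> E) |\<in>| S2 \<longrightarrow> E = None"
    using canonical_system_LeftRule[OF assms(2)] left_intro.hyps(1) by auto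
  have p: "\<sigma> (principal L c) = Con c \<phi>s"
    using substitution_principal left_intro.hyps c by (auto simp: \<phi>s_def)
  have f: "Con c \<phi>s \<in> formulas L"
    using principal_in_formulas[OF c(1)] left_intro.hyps(2) p by (metis substitution_def)
  have False if \<Gamma>: "\<forall>\<phi>. \<phi> |\<in>| \<Gamma> \<longrightarrow> v w \<phi>" and vc: "v w (Con c \<phi>s)"
    and E: "\<not> (\<exists>\<phi>. E = Some \<phi> \<and> v w \<phi>)"
  proof -
    have "supports W (\<lambda>w i. v w (\<sigma> (Atom i))) w S1"
      unfolding supports_def
    proof (intro allI impI ballI)
      fix s w' assume s: "s |\<in>| S1" and w': "w' \<in> W" "w \<le> w'"
      obtain \<Pi> E' where "s = \<Pi> \<Zsurj> E'" by (cases s)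
      moreover have "\<forall>\<phi>. \<phi> |\<in>| \<Gamma> \<longrightarrow> v w' \<phi>"
        using \<Gamma> kripke_model_persistent[OF assms(3) left_intro.prems w'(1)] w'
          left_intro.hyps(3) by (auto simp: sequent_in_sequents_iff)
      ultimately show "holds (\<lambda>i. v w' (\<sigma> (Atom i))) s"
        using left_intro.IH(1) s w'(1) by fastforce
    qed
    then have "supports W (\<lambda>w i. v w (\<phi>s ! i)) w S1"
      by (subst supports_cong[OF c(2)]) (auto simp: \<phi>s_def)
    moreover have "holds (\<lambda>i. v w (\<phi>s ! i)) s" if s: "s |\<in>| S2" for s
    proof -
      obtain \<Sigma> where \<Sigma>: "s = \<Sigma> \<Zsurj> None" using c(4) s by (cases s) auto
      \<comment> \<open>The premise for this clause has right-hand side \<open>E\<close>, which is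
        false at \<open>w\<close>, while \<Gamma> is true there. Hence some instance of an atom in
        \<Sigma> is false at \<open>w\<close>.\<close>
      then have "holds (\<lambda>i. v w (\<sigma> (Atom i))) s"
        using left_intro.IH(2) s left_intro.prems \<Gamma> E by fastforce
      then show ?thesis
        by (subst holds_clause_cong[OF c(3) s]) (auto simp: \<phi>s_def)
    qed
    ultimately show False
      using kripke_model_left[OF assms(3) left_intro.hyps(1) f left_intro.prems] vc by blast
  qed
  then show ?case by (auto simp: p)
qed fastforce+

section \<open>Extending a model to a larger language\<close>

text \<open>The guard tests the whole formula, not its main connective: an old connective applied to
  new arguments is also evaluated by the second branch. That branch is the most cautious choice,
  making a formula true only when a right rule forces it. The formula comes before the world, and
  the recursive call sits inside \<open>map\<close>, to make the recursion primitive.\<close>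

primrec extend_valuation ::
  "'c language \<Rightarrow> 'c rule set \<Rightarrow> 'w::order set \<Rightarrow> ('w \<Rightarrow> 'c formula \<Rightarrow> bool) \<Rightarrow>
    'c formula \<Rightarrow> 'w \<Rightarrow> bool" where
  "extend_valuation L G W v (Atom i) = (\<lambda>w. v w (Atom i))"
| "extend_valuation L G W v (Con c \<phi>s) = (\<lambda>w.
    if Con c \<phi>s \<in> formulas L then v w (Con c \<phi>s)
    else \<exists>S3. RightRule c S3 \<in> G \<and>
      supports W (\<lambda>w i. (map (extend_valuation L G W v) \<phi>s ! i) w) w S3)"

lemma extend_valuation_eq: "\<phi> \<in> formulas L \<Longrightarrow> extend_valuation L G W v \<phi> w = v w \<phi>"
  by (cases \<phi>) auto

text \<open>For a formula of \<open>L1\<close> the rules of its main connective already lie in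
  \<open>G1\<close>, so the given model takes care of it. For any other formula, persistence and the
  right rules follow from the choice of the valuation, and the left rules from coherence.\<close>

lemma kripke_model_extend:
  assumes L: "sublanguage L1 L2"
    and G2: "canonical_system L2 G2" "coherent G2"
    and new: "\<And>r. r \<in> G2 \<Longrightarrow> conn r \<in> connectives L1 \<Longrightarrow> r \<in> G1"
    and model: "kripke_model L1 G1 W v"
  shows "kripke_model L2 G2 W (\<lambda>w \<phi>. extend_valuation L1 G2 W v \<phi> w)"
proof -
  let ?e = "extend_valuation L1 G2 W v"
  have old: "c \<in> connectives L1" "arity L1 c = arity L2 c"
      "\<And>i w. i < arity L2 c \<Longrightarrow> ?e (\<phi>s ! i) w = v w (\<phi>s ! i)"
    if "Con c \<phi>s \<in> formulas L1" for c \<phi>s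
  proof -
    show c: "c \<in> connectives L1" "arity L1 c = arity L2 c"
      using that L by (auto simp: Con_in_formulas_iff sublanguage_def)
    show "?e (\<phi>s ! i) w = v w (\<phi>s ! i)" if "i < arity L2 c" for i w
      using Con_in_formulas_nth[OF \<open>Con c \<phi>s \<in> formulas L1\<close>] c(2) that
      by (simp add: extend_valuation_eq)
  qed
  have supports_old:
    "supports W (\<lambda>w i. ?e (\<phi>s ! i) w) w S \<longleftrightarrow> supports W (\<lambda>w i. v w (\<phi>s ! i)) w S"
    if "Con c \<phi>s \<in> formulas L1" "clauses_over (arity L2 c) S" for c \<phi>s S w
    using that(2) by (rule supports_cong) (rule old(3)[OF that(1)])
  have ext: "?e (Con c \<phi>s) w \<longleftrightarrow>
      (\<exists>S3. RightRule c S3 \<in> G2 \<and> supports W (\<lambda>w i. ?e (\<phi>s ! i) w) w S3)"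
    if f: "Con c \<phi>s \<in> formulas L2" "Con c \<phi>s \<notin> formulas L1" for c \<phi>s w
  proof -
    \<comment> \<open>\<open>map f xs ! i\<close> and \<open>f (xs ! i)\<close> are known to agree
      only below the length of \<open>xs\<close>; the clauses of a canonical rule mention no other
      index.\<close>
    have "supports W (\<lambda>w i. (map ?e \<phi>s ! i) w) w S3 \<longleftrightarrow>
        supports W (\<lambda>w i. ?e (\<phi>s ! i) w) w S3" if "RightRule c S3 \<in> G2" for S3
      using canonical_system_RightRule[OF G2(1) that] f(1)
      by (intro supports_cong[where n = "arity L2 c"]) (auto simp: Con_in_formulas_iff)
    then show ?thesis using f(2) by auto
  qed
  show ?thesis
  proof (rule kripke_modelI)
    fix w w' \<phi> assume *: "w \<in> W" "w' \<in> W" "\<phi> \<in> formulas L2" "w \<le> w'" "?e \<phi> w"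
    show "?e \<phi> w'"
    proof (cases "\<phi> \<in> formulas L1")
      case True
      then show ?thesis
        using *(4,5) kripke_model_persistent[OF model *(1,2) True] by (simp add: extend_valuation_eq)
    next
      case False
      \<comment> \<open>Atoms belong to every language, so a formula outside \<open>L1\<close> is
        compound.\<close>
      then obtain c \<phi>s where \<phi>: "\<phi> = Con c \<phi>s"
        by (cases \<phi>) (auto simp: formulas.Atom)
      have f: "Con c \<phi>s \<in> formulas L2" "Con c \<phi>s \<notin> formulas L1"
        using *(3) False \<phi> by auto
      show ?thesis
        using *(5) supports_mono[OF _ *(4)] unfolding \<phi> ext[OF f] by blast
    qed
  next
    fix c S3 \<phi>s w
    assume r: "RightRule c S3 \<in> G2" and f: "Con c \<phi>s \<in> formulas L2" and w: "w \<in> W"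
      and s: "supports W (\<lambda>w i. ?e (\<phi>s ! i) w) w S3"
    show "?e (Con c \<phi>s) w"
    proof (cases "Con c \<phi>s \<in> formulas L1")
      case True
      have "supports W (\<lambda>w i. v w (\<phi>s ! i)) w S3"
        using s canonical_system_RightRule[OF G2(1) r] supports_old[OF True] by simp
      moreover have "RightRule c S3 \<in> G1" using new[OF r] old(1)[OF True] by simp
      ultimately have "v w (Con c \<phi>s)"
        by (intro kripke_model_right[OF model _ True w])
      then show ?thesis by (simp add: extend_valuation_eq True)
    next
      case False
      then show ?thesis using r s unfolding ext[OF f False] by blast
    qed
  next
    fix c S1 S2 \<phi>s w
    assume r: "LeftRule c S1 S2 \<in> G2" and f: "Con c \<phi>s \<in> formulas L2" and w: "w \<in> W"
      and s1: "supports W (\<lambda>w i. ?e (\<phi>s ! i) w) w S1"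
      and s2: "\<And>s. s |\<in>| S2 \<Longrightarrow> holds (\<lambda>i. ?e (\<phi>s ! i) w) s"
      and e: "?e (Con c \<phi>s) w"
    show False
    proof (cases "Con c \<phi>s \<in> formulas L1")
      case True
      have c: "clauses_over (arity L2 c) S1" "clauses_over (arity L2 c) S2"
        using canonical_system_LeftRule[OF G2(1) r] by auto
      have "supports W (\<lambda>w i. v w (\<phi>s ! i)) w S1"
        using s1 c(1) supports_old[OF True] by simp
      moreover have "holds (\<lambda>i. v w (\<phi>s ! i)) s" if "s |\<in>| S2" for s
        using s2[OF that]
        by (subst holds_clause_cong[OF c(2) that, of _ "\<lambda>i. ?e (\<phi>s ! i) w"])
          (simp_all add: old(3)[OF True])
      moreover have "LeftRule c S1 S2 \<in> G1" using new[OF r] old(1)[OF True] by simp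
      ultimately have "\<not> v w (Con c \<phi>s)"
        by (intro kripke_model_left[OF model _ True w])
      then show False using e by (simp add: extend_valuation_eq True)
    next
      case False
      then obtain S3 where S3: "RightRule c S3 \<in> G2" "supports W (\<lambda>w i. ?e (\<phi>s ! i) w) w S3"
        using e unfolding ext[OF f False] by blast
      \<comment> \<open>Taking the later world to be \<open>w\<close> itself turns the two supported
        sets into classical statements. The truth values of the arguments at \<open>w\<close> then
        form one assignment satisfying all three sets of clauses, which coherence forbids.\<close>
      have "satisfies (\<lambda>i. ?e (\<phi>s ! i) w) s" if "s |\<in>| S1 |\<union>| S2 |\<union>| S3" for s
        using that s2 supportsD[OF s1 _ w order_refl] supportsD[OF S3(2) _ w order_refl]
        unfolding satisfies_iff_holds by auto
      then show False
        using G2(2) r S3(1) unfolding coherent_def by blast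
    qed
  qed
qed

section \<open>The canonical model\<close>

definition entails ::
  "'c language \<Rightarrow> 'c rule set \<Rightarrow> 'c formula sequent set \<Rightarrow> 'c formula set \<Rightarrow>
    'c formula option \<Rightarrow> bool" where
  "entails L G \<S> T E \<longleftrightarrow> (\<exists>\<Gamma>. fset \<Gamma> \<subseteq> T \<and> derivable L G \<S> (\<Gamma> \<Zsurj> E))"

text \<open>Maximality relative to a right-hand side takes the place of primeness, since the
  language need not contain a disjunction or any other particular connective. For
  \<open>E = None\<close> these are the maximal consistent sets.\<close>

definition maximal_for ::
  "'c language \<Rightarrow> 'c rule set \<Rightarrow> 'c formula sequent set \<Rightarrow> 'c formula option \<Rightarrow>
    'c formula set \<Rightarrow> bool" where
  "maximal_for L G \<S> E T \<longleftrightarrow> T \<subseteq> formulas L \<and> set_option E \<subseteq> formulas L \<and>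
    \<not> entails L G \<S> T E \<and> (\<forall>\<phi>\<in>formulas L - T. entails L G \<S> (insert \<phi> T) E)"

definition worlds ::
  "'c language \<Rightarrow> 'c rule set \<Rightarrow> 'c formula sequent set \<Rightarrow> 'c formula set set" where
  "worlds L G \<S> = {T. \<exists>E. maximal_for L G \<S> E T}"

section \<open>Lindenbaum extensions and completeness for the canonical worlds\<close>

lemma derivable_weaken:
  assumes "derivable L G \<S> (\<Gamma> \<Zsurj> E)" "\<Gamma> |\<subseteq>| \<Delta>" "fset \<Delta> \<subseteq> formulas L"
  shows "derivable L G \<S> (\<Delta> \<Zsurj> E)"
  using derivable.weak_left[OF assms(1,3)] assms(2) by (simp add: sup.absorb2)

lemma entails_mono: "entails L G \<S> T E \<Longrightarrow> T \<subseteq> T' \<Longrightarrow> entails L G \<S> T' E"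
  unfolding entails_def by blast

text \<open>Keep the part of the finite context that lies in \<open>T\<close> and weaken by the
  whole of \<Delta>, so that \<Delta> appears explicitly, as in the premise of a rule.\<close>

lemma entails_Un_fset:
  assumes "entails L G \<S> (T \<union> fset \<Delta>) E" "T \<subseteq> formulas L" "fset \<Delta> \<subseteq> formulas L"
  obtains \<Gamma> where "fset \<Gamma> \<subseteq> T" "derivable L G \<S> (\<Gamma> |\<union>| \<Delta> \<Zsurj> E)"
proof -
  obtain \<Gamma> where \<Gamma>: "fset \<Gamma> \<subseteq> T \<union> fset \<Delta>" "derivable L G \<S> (\<Gamma> \<Zsurj> E)"
    using assms(1) by (auto simp: entails_def)
  let ?\<Gamma> = "ffilter (\<lambda>\<phi>. \<phi> \<in> T) \<Gamma>"
  have "derivable L G \<S> (?\<Gamma> |\<union>| \<Delta> \<Zsurj> E)"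
    by (rule derivable_weaken[OF \<Gamma>(2)]) (use \<Gamma>(1) assms in auto)
  then show thesis by (intro that[of ?\<Gamma>]) auto
qed

text \<open>Zorn's lemma: a derivation uses a finite context, so a context inside the union of a
  chain already lies in one member.\<close>

lemma maximal_for_extends:
  assumes "T \<subseteq> formulas L" "set_option E \<subseteq> formulas L" "\<not> entails L G \<S> T E"
  obtains M where "T \<subseteq> M" "maximal_for L G \<S> E M"
proof -
  let ?A = "{T'. T \<subseteq> T' \<and> T' \<subseteq> formulas L \<and> \<not> entails L G \<S> T' E}"
  have "\<exists>M\<in>?A. \<forall>X\<in>?A. M \<subseteq> X \<longrightarrow> X = M"
  proof (rule subset_Zorn_nonempty)
    show "?A \<noteq> {}" using assms by auto
  next
    fix C assume C: "C \<noteq> {}" "subset.chain ?A C"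
    have "\<not> entails L G \<S> (\<Union>C) E"
    proof
      assume "entails L G \<S> (\<Union>C) E"
      then obtain \<Gamma> where \<Gamma>: "fset \<Gamma> \<subseteq> \<Union>C" "derivable L G \<S> (\<Gamma> \<Zsurj> E)"
        by (auto simp: entails_def)
      obtain B where "B \<in> C" "fset \<Gamma> \<subseteq> B"
        using finite_subset_Union_chain[OF finite_fset \<Gamma>(1) C] .
      then show False
        using C(2) \<Gamma>(2) by (auto simp: subset.chain_def entails_def)
    qed
    then show "\<Union>C \<in> ?A"
      using C by (auto simp: subset.chain_def)
  qed
  then obtain M where M: "M \<in> ?A" "\<forall>X\<in>?A. M \<subseteq> X \<longrightarrow> X = M" ..
  \<comment> \<open>Otherwise \<open>insert \<phi> M\<close> would belong to \<open>?A\<close>, and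
    maximality would make it equal to \<open>M\<close>.\<close>
  have "entails L G \<S> (insert \<phi> M) E" if "\<phi> \<in> formulas L - M" for \<phi>
    using M(1) bspec[OF M(2), of "insert \<phi> M"] that by auto
  then have "maximal_for L G \<S> E M"
    using M(1) assms(2) by (auto simp: maximal_for_def)
  then show thesis using M(1) that by blast
qed

text \<open>Let \<open>T\<close> be maximal for \<open>E\<close>. If the conclusion \<phi> were
  outside \<open>T\<close>, then \<open>T\<close> with \<phi> would entail \<open>E\<close>, and a
  cut on \<phi> would make \<open>T\<close> alone entail \<open>E\<close>. An empty conclusion
  yields \<open>E\<close> by weakening.\<close>

lemma derivable_holds_in_world:
  assumes "derivable L G \<S> s" "s \<in> sequents L" "T \<in> worlds L G \<S>"
  shows "holds (\<lambda>\<phi>. \<phi> \<in> T) s"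
proof (cases s)
  case (Sequent \<Gamma> F)
  obtain E where E: "maximal_for L G \<S> E T" using assms(3) by (auto simp: worlds_def)
  have "\<exists>\<phi>. F = Some \<phi> \<and> \<phi> \<in> T" if \<Gamma>: "fset \<Gamma> \<subseteq> T"
  proof (cases F)
    case None
    then have "derivable L G \<S> (\<Gamma> \<Zsurj> E)"
      using assms(1) Sequent E
      by (cases E) (auto simp: maximal_for_def intro: derivable.weak_right)
    then show ?thesis using E \<Gamma> by (auto simp: maximal_for_def entails_def)
  next
    case (Some \<phi>)
    have \<phi>: "\<phi> \<in> formulas L" using assms(2) Sequent Some by (simp add: sequent_in_sequents_iff)
    have "\<phi> \<in> T"
    proof (rule ccontr)
      assume "\<phi> \<notin> T"
      then have "entails L G \<S> (T \<union> fset {|\<phi>|}) E"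
        using E \<phi> by (simp add: maximal_for_def)
      then obtain \<Delta> where \<Delta>: "fset \<Delta> \<subseteq> T" "derivable L G \<S> (\<Delta> |\<union>| {|\<phi>|} \<Zsurj> E)"
        by (rule entails_Un_fset) (use E \<phi> in \<open>auto simp: maximal_for_def\<close>)
      then have "derivable L G \<S> (\<Gamma> |\<union>| \<Delta> \<Zsurj> E)"
        using derivable.cut assms(1) Sequent Some by fastforce
      then show False
        using E \<Gamma> \<Delta> by (auto simp: maximal_for_def entails_def)
    qed
    then show ?thesis using Some by blast
  qed
  then show ?thesis using Sequent by auto
qed

text \<open>Otherwise \<open>T\<close> together with \<Delta> extends to a world maximal for
  \<open>E\<close>. By assumption that world contains the formula in \<open>E\<close>, which it then
  entails by an axiom.\<close>

lemma holds_in_worlds_derivable: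
  assumes "T \<subseteq> formulas L" "(\<Delta> \<Zsurj> E) \<in> sequents L"
    and "\<And>T'. T' \<in> worlds L G \<S> \<Longrightarrow> T \<subseteq> T' \<Longrightarrow> holds (\<lambda>\<phi>. \<phi> \<in> T') (\<Delta> \<Zsurj> E)"
  shows "\<exists>\<Gamma>. fset \<Gamma> \<subseteq> T \<and> derivable L G \<S> (\<Gamma> |\<union>| \<Delta> \<Zsurj> E)"
proof -
  have f: "fset \<Delta> \<subseteq> formulas L" "set_option E \<subseteq> formulas L"
    using assms(2) by (auto simp: sequent_in_sequents_iff)
  have "entails L G \<S> (T \<union> fset \<Delta>) E"
  proof (rule ccontr)
    assume "\<not> entails L G \<S> (T \<union> fset \<Delta>) E"
    then obtain M where M: "T \<union> fset \<Delta> \<subseteq> M" "maximal_for L G \<S> E M"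
      using maximal_for_extends[of "T \<union> fset \<Delta>" L E] assms(1) f by auto
    then obtain \<phi> where \<phi>: "E = Some \<phi>" "\<phi> \<in> M"
      using assms(3)[of M] by (auto simp: worlds_def)
    have "entails L G \<S> M E"
      unfolding entails_def
      by (rule exI[of _ "{|\<phi>|}"]) (use \<phi> f in \<open>auto intro: derivable.axiom\<close>)
    then show False using M(2) by (simp add: maximal_for_def)
  qed
  from entails_Un_fset[OF this assms(1) f(1)] show ?thesis by blast
qed

text \<open>Introduction rules demand one context for all premises. There are finitely many clauses,
  so the union of their separate finite contexts serves for all of them.\<close>

lemma uniform_context:
  assumes "\<And>s. s |\<in>| S \<Longrightarrow> \<exists>\<Gamma>. fset \<Gamma> \<subseteq> T \<and> P \<Gamma> s"
    and "\<And>\<Gamma> \<Delta> s. P \<Gamma> s \<Longrightarrow> s |\<in>| S \<Longrightarrow> \<Gamma> |\<subseteq>| \<Delta> \<Longrightarrow> fset \<Delta> \<subseteq> T \<Longrightarrow> P \<Delta> s"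
  shows "\<exists>\<Gamma>. fset \<Gamma> \<subseteq> T \<and> (\<forall>s. s |\<in>| S \<longrightarrow> P \<Gamma> s)"
proof -
  from assms(1) have "\<forall>s\<in>fset S. \<exists>\<Gamma>. fset \<Gamma> \<subseteq> T \<and> P \<Gamma> s"
    by (intro ballI)
  from bchoice[OF this] obtain f where f: "\<forall>s\<in>fset S. fset (f s) \<subseteq> T \<and> P (f s) s" ..
  let ?\<Gamma> = "ffUnion (f |`| S)"
  have \<Gamma>: "fset ?\<Gamma> = (\<Union>s\<in>fset S. fset (f s))"
    by (simp add: ffUnion.rep_eq)
  have sub: "fset ?\<Gamma> \<subseteq> T"
    unfolding \<Gamma> using f by (intro UN_least) simp
  moreover have "P ?\<Gamma> s" if s: "s |\<in>| S" for s
  proof (rule assms(2)[OF _ s _ sub])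
    show "P (f s) s" using f s by simp
    show "f s |\<subseteq>| ?\<Gamma>" unfolding less_eq_fset.rep_eq \<Gamma> using s by (rule UN_upper)
  qed
  ultimately show ?thesis by blast
qed

text \<open>Clauses supported at a world \<open>T\<close> become derivable premises with a common
  finite context from \<open>T\<close>, and the introduction rule is then applied in
  \<open>G\<close>. A right rule puts its conclusion into \<open>T\<close>; a left rule would make
  \<open>T\<close> entail the right-hand side for which it is maximal.\<close>

lemma kripke_model_worlds:
  fixes L :: "'c language"
  assumes G: "canonical_system L G"
  shows "kripke_model L G (worlds L G \<S>) (\<lambda>T \<phi>. \<phi> \<in> T)"
proof -
  let ?W = "worlds L G \<S>" and ?v = "\<lambda>(T :: 'c formula set) \<phi>. \<phi> \<in> T"
  \<comment> \<open>The premise that a rule obtains from the clause \<open>s\<close>, phrased as a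
    predicate of context and clause to fit \<open>uniform_context\<close>.\<close>
  let ?d = "\<lambda>\<sigma> \<Gamma> s. \<exists>\<Pi> E. s = \<Pi> \<Zsurj> E \<and> derivable L G \<S>
      (\<Gamma> |\<union>| (\<lambda>i. \<sigma> (Atom i)) |`| \<Pi> \<Zsurj> map_option (\<lambda>i. \<sigma> (Atom i)) E)"
  have instantiate: "\<exists>\<sigma>. substitution L \<sigma> \<and> \<sigma> (principal L c) = Con c \<phi>s \<and>
      (\<forall>i. \<sigma> (Atom i) \<in> formulas L) \<and> (\<forall>i < arity L c. \<sigma> (Atom i) = \<phi>s ! i)"
    if f: "Con c \<phi>s \<in> formulas L" for c \<phi>s
  proof -
    \<comment> \<open>Atoms beyond the arity are left unchanged, which keeps every value in
      \<open>L\<close>.\<close>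
    let ?f = "\<lambda>i. if i < arity L c then \<phi>s ! i else Atom i"
    have 1: "?f i \<in> formulas L" for i
      using Con_in_formulas_nth[OF f] by (auto intro: formulas.Atom)
    have "map ?f [0..<arity L c] = \<phi>s"
      using f by (auto simp: Con_in_formulas_iff intro: nth_equalityI)
    then have "subst ?f (principal L c) = Con c \<phi>s"
      by (simp add: principal_def comp_def)
    then show ?thesis
      using 1 substitution_subst[of ?f L] by (intro exI[of _ "subst ?f"]) auto
  qed
  have formulas_image: "fset ((\<lambda>i. \<sigma> (Atom i)) |`| \<Pi>) \<subseteq> formulas L"
    if "\<forall>i. \<sigma> (Atom i) \<in> formulas L" for \<sigma> :: "'c formula \<Rightarrow> 'c formula" and \<Pi>
    using that by auto
  have weaken: "?d \<sigma> \<Delta> s"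
    if premise: "?d \<sigma> \<Gamma> s" and "\<Gamma> |\<subseteq>| \<Delta>" "fset \<Delta> \<subseteq> formulas L"
      "\<forall>i. \<sigma> (Atom i) \<in> formulas L"
    for \<sigma> \<Gamma> \<Delta> s
  proof -
    obtain \<Pi> E where s: "s = \<Pi> \<Zsurj> E" and d: "derivable L G \<S>
        (\<Gamma> |\<union>| (\<lambda>i. \<sigma> (Atom i)) |`| \<Pi> \<Zsurj> map_option (\<lambda>i. \<sigma> (Atom i)) E)"
      using premise by blast
    have "derivable L G \<S> (\<Delta> |\<union>| (\<lambda>i. \<sigma> (Atom i)) |`| \<Pi> \<Zsurj> map_option (\<lambda>i. \<sigma> (Atom i)) E)"
      by (rule derivable_weaken[OF d]) (use that in auto)
    then show ?thesis using s by blast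
  qed
  have common_context: "\<exists>\<Gamma>. fset \<Gamma> \<subseteq> T \<and> (\<forall>s. s |\<in>| S \<longrightarrow> ?d \<sigma> \<Gamma> s)"
    if T: "T \<subseteq> formulas L" and c: "clauses_over (arity L c) S"
      and s: "supports ?W (\<lambda>w i. ?v w (\<phi>s ! i)) T S"
      and \<sigma>: "\<forall>i. \<sigma> (Atom i) \<in> formulas L" "\<forall>i < arity L c. \<sigma> (Atom i) = \<phi>s ! i"
    for T c S \<phi>s \<sigma>
  proof -
    have s': "supports ?W (\<lambda>w i. ?v w (\<sigma> (Atom i))) T S"
      using s supports_cong[OF c, of ?W "\<lambda>w i. ?v w (\<phi>s ! i)"] \<sigma>(2) by metis
    have "\<exists>\<Gamma>. fset \<Gamma> \<subseteq> T \<and> ?d \<sigma> \<Gamma> s" if "s |\<in>| S" for s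
    proof -
      obtain \<Pi> E where \<Pi>: "s = \<Pi> \<Zsurj> E" by (cases s)
      have "\<exists>\<Gamma>. fset \<Gamma> \<subseteq> T \<and> derivable L G \<S>
          (\<Gamma> |\<union>| (\<lambda>i. \<sigma> (Atom i)) |`| \<Pi> \<Zsurj> map_option (\<lambda>i. \<sigma> (Atom i)) E)"
      proof (rule holds_in_worlds_derivable[OF T])
        show "((\<lambda>i. \<sigma> (Atom i)) |`| \<Pi> \<Zsurj> map_option (\<lambda>i. \<sigma> (Atom i)) E) \<in> sequents L"
          using \<sigma>(1) by (auto simp: sequent_in_sequents_iff option.set_map)
      next
        fix T' assume "T' \<in> ?W" "T \<subseteq> T'"
        then have "holds (\<lambda>i. ?v T' (\<sigma> (Atom i))) s"
          using supportsD[OF s' \<open>s |\<in>| S\<close>] by blast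
        then show "holds (?v T') ((\<lambda>i. \<sigma> (Atom i)) |`| \<Pi> \<Zsurj> map_option (\<lambda>i. \<sigma> (Atom i)) E)"
          using \<Pi> by auto
      qed
      then show ?thesis using \<Pi> by blast
    qed
    moreover have "?d \<sigma> \<Delta> s" if "?d \<sigma> \<Gamma> s" "\<Gamma> |\<subseteq>| \<Delta>" "fset \<Delta> \<subseteq> T" for \<Gamma> \<Delta> s
      using weaken[OF that(1,2) _ \<sigma>(1)] that(3) T by (meson order_trans)
    ultimately show ?thesis
      by (rule uniform_context)
  qed
  show ?thesis
  proof (rule kripke_modelI)
    show "?v w' \<phi>" if "w \<le> w'" "?v w \<phi>" for w w' \<phi>
      using that by blast
  next
    fix c S3 \<phi>s T
    assume r: "RightRule c S3 \<in> G" and f: "Con c \<phi>s \<in> formulas L" and T: "T \<in> ?W"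
      and s: "supports ?W (\<lambda>w i. ?v w (\<phi>s ! i)) T S3"
    obtain \<sigma> where \<sigma>: "substitution L \<sigma>" "\<sigma> (principal L c) = Con c \<phi>s"
        "\<forall>i. \<sigma> (Atom i) \<in> formulas L" "\<forall>i < arity L c. \<sigma> (Atom i) = \<phi>s ! i"
      using instantiate[OF f] by blast
    have T_formulas: "T \<subseteq> formulas L" using T by (auto simp: worlds_def maximal_for_def)
    obtain \<Gamma> where \<Gamma>: "fset \<Gamma> \<subseteq> T" "\<forall>s. s |\<in>| S3 \<longrightarrow> ?d \<sigma> \<Gamma> s"
      using common_context[OF T_formulas _ s \<sigma>(3,4)] canonical_system_RightRule[OF G r] by blast
    have "derivable L G \<S> (\<Gamma> \<Zsurj> Some (\<sigma> (principal L c)))"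
      by (rule derivable.right_intro[OF r \<sigma>(1)]) (use \<Gamma> T_formulas in auto)
    then show "?v T (Con c \<phi>s)"
      using derivable_holds_in_world[OF _ _ T] derivable_in_sequents[OF _ G] \<Gamma>(1) \<sigma>(2)
      by fastforce
  next
    fix c S1 S2 \<phi>s T
    assume r: "LeftRule c S1 S2 \<in> G" and f: "Con c \<phi>s \<in> formulas L" and T: "T \<in> ?W"
      and s1: "supports ?W (\<lambda>w i. ?v w (\<phi>s ! i)) T S1"
      and s2: "\<And>s. s |\<in>| S2 \<Longrightarrow> holds (\<lambda>i. ?v T (\<phi>s ! i)) s"
      and cT: "?v T (Con c \<phi>s)"
    have c: "clauses_over (arity L c) S1" "clauses_over (arity L c) S2"
      using canonical_system_LeftRule[OF G r] by auto
    obtain \<sigma> where \<sigma>: "substitution L \<sigma>" "\<sigma> (principal L c) = Con c \<phi>s"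
        "\<forall>i. \<sigma> (Atom i) \<in> formulas L" "\<forall>i < arity L c. \<sigma> (Atom i) = \<phi>s ! i"
      using instantiate[OF f] by blast
    obtain E where E: "maximal_for L G \<S> E T" using T by (auto simp: worlds_def)
    then have T_formulas: "T \<subseteq> formulas L" by (auto simp: maximal_for_def)
    obtain \<Gamma>1 where \<Gamma>1: "fset \<Gamma>1 \<subseteq> T" "\<forall>s. s |\<in>| S1 \<longrightarrow> ?d \<sigma> \<Gamma>1 s"
      using common_context[OF T_formulas c(1) s1 \<sigma>(3,4)] by blast
    \<comment> \<open>The premises from \<open>S2\<close> take as right-hand side the
      \<open>E\<close> for which \<open>T\<close> is maximal.\<close>
    let ?d2 = "\<lambda>\<Gamma> s. \<forall>\<Sigma>. s = \<Sigma> \<Zsurj> None \<longrightarrow>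
      derivable L G \<S> (\<Gamma> |\<union>| (\<lambda>i. \<sigma> (Atom i)) |`| \<Sigma> \<Zsurj> E)"
    have weaken2: "?d2 \<Delta> s" if "?d2 \<Gamma> s" "\<Gamma> |\<subseteq>| \<Delta>" "fset \<Delta> \<subseteq> T" for \<Gamma> \<Delta> s
    proof (intro allI impI)
      fix \<Sigma> assume "s = \<Sigma> \<Zsurj> None"
      then have d: "derivable L G \<S> (\<Gamma> |\<union>| (\<lambda>i. \<sigma> (Atom i)) |`| \<Sigma> \<Zsurj> E)"
        using that by blast
      show "derivable L G \<S> (\<Delta> |\<union>| (\<lambda>i. \<sigma> (Atom i)) |`| \<Sigma> \<Zsurj> E)"
        by (rule derivable_weaken[OF d]) (use that T_formulas \<sigma>(3) in auto)
    qed
    have "\<exists>\<Gamma>. fset \<Gamma> \<subseteq> T \<and> ?d2 \<Gamma> s" if s: "s |\<in>| S2" for s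
    proof (cases "\<exists>\<Sigma>. s = \<Sigma> \<Zsurj> None")
      case True
      then obtain \<Sigma> where \<Sigma>: "s = \<Sigma> \<Zsurj> None" by blast
      let ?\<Delta> = "(\<lambda>i. \<sigma> (Atom i)) |`| \<Sigma>"
      have "holds (\<lambda>i. ?v T (\<sigma> (Atom i))) s"
        using s2[OF s] by (subst holds_clause_cong[OF c(2) s]) (simp_all add: \<sigma>(4))
      then obtain i where i: "i |\<in>| \<Sigma>" "\<sigma> (Atom i) \<notin> T" using \<Sigma> by auto
      \<comment> \<open>The clause holds at \<open>T\<close> and has no right-hand side, so one of
        its instantiated atoms is missing from \<open>T\<close>; adding it entails \<open>E\<close>
        by maximality.\<close>
      have "entails L G \<S> (insert (\<sigma> (Atom i)) T) E"
        using E i(2) \<sigma>(3) by (simp add: maximal_for_def)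
      then have "entails L G \<S> (T \<union> fset ?\<Delta>) E"
        by (rule entails_mono) (use i(1) in auto)
      from entails_Un_fset[OF this T_formulas formulas_image[OF \<sigma>(3)]]
      obtain \<Gamma> where "fset \<Gamma> \<subseteq> T" "derivable L G \<S> (\<Gamma> |\<union>| ?\<Delta> \<Zsurj> E)" .
      then show ?thesis using \<Sigma> by blast
    next
      case False
      then show ?thesis by (intro exI[of _ "{||}"]) auto
    qed
    then have "\<exists>\<Gamma>. fset \<Gamma> \<subseteq> T \<and> (\<forall>s. s |\<in>| S2 \<longrightarrow> ?d2 \<Gamma> s)"
      by (rule uniform_context) (assumption, rule weaken2)
    then obtain \<Gamma>2 where \<Gamma>2: "fset \<Gamma>2 \<subseteq> T" "\<And>s. s |\<in>| S2 \<Longrightarrow> ?d2 \<Gamma>2 s"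
      by blast
    let ?\<Gamma> = "\<Gamma>1 |\<union>| \<Gamma>2"
    have \<Gamma>: "fset ?\<Gamma> \<subseteq> T" using \<Gamma>1 \<Gamma>2 by auto
    have "derivable L G \<S> (finsert (\<sigma> (principal L c)) ?\<Gamma> \<Zsurj> E)"
    proof (rule derivable.left_intro[OF r \<sigma>(1)])
      show "(?\<Gamma> \<Zsurj> E) \<in> sequents L"
        using E \<Gamma> by (auto simp: sequent_in_sequents_iff maximal_for_def)
      have "?d \<sigma> ?\<Gamma> s" if "s |\<in>| S1" for s
        by (rule weaken[OF \<Gamma>1(2)[rule_format, OF that] _ _ \<sigma>(3)])
          (use \<Gamma> T_formulas in auto)
      then show "\<forall>\<Pi> E'. (\<Pi> \<Zsurj> E') |\<in>| S1 \<longrightarrow> derivable L G \<S>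
          (?\<Gamma> |\<union>| (\<lambda>i. \<sigma> (Atom i)) |`| \<Pi> \<Zsurj> map_option (\<lambda>i. \<sigma> (Atom i)) E')"
        by blast
      have "?d2 ?\<Gamma> s" if "s |\<in>| S2" for s
        using weaken2[OF \<Gamma>2(2)[OF that] _ \<Gamma>] by blast
      then show "\<forall>\<Sigma>. (\<Sigma> \<Zsurj> None) |\<in>| S2 \<longrightarrow>
          derivable L G \<S> (?\<Gamma> |\<union>| (\<lambda>i. \<sigma> (Atom i)) |`| \<Sigma> \<Zsurj> E)"
        by blast
    qed
    moreover have "fset (finsert (\<sigma> (principal L c)) ?\<Gamma>) \<subseteq> T"
      using \<Gamma> cT \<sigma>(2) by simp
    ultimately show False
      using E unfolding maximal_for_def entails_def by blast
  qed
qed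

section \<open>Conservativity\<close>

theorem theorem7p3:
  fixes L1 L2 :: "'c language" and G1 G2 R :: "'c rule set"
  assumes "sublanguage L1 L2"
    and "canonical_system L1 G1" and "coherent G1"
    and "canonical_system L2 G2" and "coherent G2"
    and "G2 = G1 \<union> R"
    and "\<forall>r\<in>R. conn r \<in> connectives L2 - connectives L1"
  shows "\<forall>\<S> s. \<S> \<subseteq> sequents L1 \<longrightarrow> s \<in> sequents L1 \<longrightarrow>
    (derivable L1 G1 \<S> s \<longleftrightarrow> derivable L2 G2 \<S> s)"
proof (intro allI impI iffI)
  fix \<S> s assume "derivable L1 G1 \<S> s"
  then show "derivable L2 G2 \<S> s"
    using derivable_sublanguage assms(1,2,6) by blast
next
  fix \<S> s assume \<S>: "\<S> \<subseteq> sequents L1" and s: "s \<in> sequents L1" and d: "derivable L2 G2 \<S> s"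
  let ?W = "worlds L1 G1 \<S>"
  \<comment> \<open>The worlds come from \<open>G1\<close> alone, but formulas outside
    \<open>L1\<close> are evaluated by the right rules of \<open>G2\<close>.\<close>
  let ?e = "\<lambda>w \<phi>. extend_valuation L1 G2 ?W (\<lambda>T \<phi>. \<phi> \<in> T) \<phi> w"
  \<comment> \<open>Sequents of \<open>L1\<close> keep their meaning under the extension: \<S> stays
    true at every world, and what soundness says about \<open>s\<close> can be read back in the
    canonical model.\<close>
  have eq: "holds (?e T) t \<longleftrightarrow> holds (\<lambda>\<phi>. \<phi> \<in> T) t" if "t \<in> sequents L1" for t T
    using that by (intro holds_cong extend_valuation_eq) (auto simp: sequents_def)
  have model: "kripke_model L2 G2 ?W ?e"
    using assms kripke_model_worlds[OF assms(2)] by (intro kripke_model_extend) auto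
  have "holds (?e T) t" if "t \<in> \<S>" "T \<in> ?W" for t T
    using derivable_holds_in_world[OF derivable.assumption] that \<S> eq by blast
  then have "holds (?e T) s" if "T \<in> ?W" for T
    using derivable_sound[OF d assms(4) model] that by blast
  then have valid: "holds (\<lambda>\<phi>. \<phi> \<in> T) s" if "T \<in> ?W" for T
    using that eq[OF s] by blast
  obtain \<Delta> E where \<Delta>: "s = \<Delta> \<Zsurj> E" by (cases s)
  \<comment> \<open>With the empty set in place of \<open>T\<close> every world is considered, and
    the extra context must be empty.\<close>
  have "\<exists>\<Gamma>. fset \<Gamma> \<subseteq> {} \<and> derivable L1 G1 \<S> (\<Gamma> |\<union>| \<Delta> \<Zsurj> E)"
    by (rule holds_in_worlds_derivable) (use s valid \<Delta> in auto)
  then obtain \<Gamma> where \<Gamma>: "fset \<Gamma> = fset {||}" "derivable L1 G1 \<S> (\<Gamma> |\<union>| \<Delta> \<Zsurj> E)"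
    by auto
  then show "derivable L1 G1 \<S> s"
    using \<Delta> unfolding fset_inject by simp
qed

end
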